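(* Let $n,k\ge 1$ and let $F_1,\ldots,F_k$ be subsets of the edge set $E(K_{n,n})$ of the complete bipartite graph with both sides of size $n$. If $$\sum_{i\in I}|F_i|>n|I|(|I|-1)\quad\text{for every nonempty } I\subseteq[k],$$ then the system $(F_1,\ldots,F_k)$ has a rainbow matching, i.e. there exist pairwise disjoint edges $e_1,\ldots,e_k$ with $e_i\in F_i$ for each $i$.
   Context: $[k]=\{1,\ldots,k\}$. A rainbow matching for $(F_1,\ldots,F_k)$ is a choice of pairwise disjoint edges $e_i\in F_i$, one from each $F_i$. *)

theory Defs
  imports Main
begin

text \<open>The complete bipartite graph K_{n,n}: left vertices and right vertices are both
{0..<n}; an edge is a pair (a, b) joining left vertex a to right vertex b.\<close>
definition edges_Knn :: "nat \<Rightarrow> (nat \<times> nat) set" where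
  "edges_Knn n = {0..<n} \<times> {0..<n}"

definition disjoint_edges :: "nat \<times> nat \<Rightarrow> nat \<times> nat \<Rightarrow> bool" where
  "disjoint_edges e f \<longleftrightarrow> fst e \<noteq> fst f \<and> snd e \<noteq> snd f"

definition has_rainbow_matching :: "nat \<Rightarrow> (nat \<Rightarrow> (nat \<times> nat) set) \<Rightarrow> bool" where
  "has_rainbow_matching k F \<longleftrightarrow>
     (\<exists>e :: nat \<Rightarrow> nat \<times> nat.
        (\<forall>i\<in>{1..k}. e i \<in> F i) \<and>
        (\<forall>i\<in>{1..k}. \<forall>j\<in>{1..k}. i \<noteq> j \<longrightarrow> disjoint_edges (e i) (e j)))"

end

theory Submission
  imports Defs
begin

text \<open>
  Pushing all columns and then all rows towards the origin keeps the sizes and creates no new rainbow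
  matchings, so each \<open>F i\<close> may be assumed to be a Young diagram. Then only the corner
  \<open>[k] \<times> [k]\<close> matters, and a first row (column) of length at least \<open>k\<close> may be extended to length \<open>n\<close>.

  Induct on the number \<open>k\<close> of colours. Call \<open>(\<Sum>i\<in>J. |F i|) - n |J| (|J| - 1)\<close> the slack of \<open>J\<close>, and let \<open>J\<close> be a
  nonempty proper set of colours of minimal slack. If the other colours satisfy the hypothesis outside
  the first \<open>|J|\<close> rows and columns, both parts are matched by induction, \<open>J\<close> in its corner square.
  Otherwise every nonempty proper set has slack greater than \<open>(k - 1)\<^sup>2\<close>. In that case use the smallest
  diagram \<open>F c\<close>: place \<open>c\<close> at the end of its first row (or column, whichever is longer), which has length
  \<open>y = n\<close> or \<open>y < k\<close>, delete that row and column, and induct. If \<open>y = n\<close>, minimality of \<open>|F c|\<close> gives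
  \<open>(\<Sum>i\<in>I. |F i|) > n |I|\<^sup>2\<close> for sets \<open>I\<close> of other colours, which pays for the deletion. If \<open>y < k\<close>, then
  \<open>|F c| \<le> y\<^sup>2 \<le> (k - 1)\<^sup>2\<close> is absorbed by the slack of \<open>I \<union> {c}\<close>.
\<close>

section \<open>Rainbow matchings and the size condition\<close>

text \<open>Pairwise disjointness is encoded as injectivity of both coordinates. Colours form an
  arbitrary set \<open>K\<close>, so that the induction can pass to any subset of it.\<close>

definition rainbow :: "'a set \<Rightarrow> ('a \<Rightarrow> (nat \<times> nat) set) \<Rightarrow> bool" where
  "rainbow K F \<longleftrightarrow>
     (\<exists>e. (\<forall>i\<in>K. e i \<in> F i) \<and> inj_on (\<lambda>i. fst (e i)) K \<and> inj_on (\<lambda>i. snd (e i)) K)"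

definition hall_cond :: "nat \<Rightarrow> 'a set \<Rightarrow> ('a \<Rightarrow> (nat \<times> nat) set) \<Rightarrow> bool" where
  "hall_cond n K F \<longleftrightarrow>
     (\<forall>I\<subseteq>K. I \<noteq> {} \<longrightarrow> n * card I * (card I - 1) < (\<Sum>i\<in>I. card (F i)))"

definition hall_sufficient :: "'a set \<Rightarrow> bool" where
  "hall_sufficient K \<longleftrightarrow>
     (\<forall>n F. (\<forall>i\<in>K. F i \<subseteq> {..<n} \<times> {..<n}) \<longrightarrow> hall_cond n K F \<longrightarrow> rainbow K F)"

definition down_closed :: "(nat \<times> nat) set \<Rightarrow> bool" where
  "down_closed D \<longleftrightarrow> (\<forall>x y x' y'. (x, y) \<in> D \<longrightarrow> x' \<le> x \<longrightarrow> y' \<le> y \<longrightarrow> (x', y') \<in> D)"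

lemma down_closedD: "down_closed D \<Longrightarrow> (x, y) \<in> D \<Longrightarrow> x' \<le> x \<Longrightarrow> y' \<le> y \<Longrightarrow> (x', y') \<in> D"
  unfolding down_closed_def by blast

lemma rainbowI:
  assumes "\<And>i. i \<in> K \<Longrightarrow> (x i, y i) \<in> F i" "inj_on x K" "inj_on y K"
  shows "rainbow K F"
  unfolding rainbow_def by (rule exI[of _ "\<lambda>i. (x i, y i)"]) (use assms in auto)

lemma rainbowE:
  assumes "rainbow K F"
  obtains x y where "\<And>i. i \<in> K \<Longrightarrow> (x i, y i) \<in> F i" "inj_on x K" "inj_on y K"
proof -
  obtain e where "\<forall>i\<in>K. e i \<in> F i" "inj_on (\<lambda>i. fst (e i)) K" "inj_on (\<lambda>i. snd (e i)) K"
    using assms unfolding rainbow_def by blast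
  then show ?thesis using that[of "\<lambda>i. fst (e i)" "\<lambda>i. snd (e i)"] by simp
qed

lemma rainbow_mono: "rainbow K F \<Longrightarrow> (\<And>i. i \<in> K \<Longrightarrow> F i \<subseteq> G i) \<Longrightarrow> rainbow K G"
  by (erule rainbowE, rule rainbowI) blast+

lemma rainbow_swap: "rainbow K (\<lambda>i. prod.swap ` F i) \<Longrightarrow> rainbow K F"
  by (erule rainbowE, rule_tac x = y and y = x in rainbowI) force+

lemma hall_cond_subset: "hall_cond n K F \<Longrightarrow> J \<subseteq> K \<Longrightarrow> hall_cond n J F"
  unfolding hall_cond_def by blast

lemma hall_condD:
  "hall_cond n K F \<Longrightarrow> I \<subseteq> K \<Longrightarrow> I \<noteq> {} \<Longrightarrow> n * card I * (card I - 1) < (\<Sum>i\<in>I. card (F i))"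
  unfolding hall_cond_def by blast

lemma hall_cond_mono:
  assumes "hall_cond n K F" "\<And>i. i \<in> K \<Longrightarrow> card (F i) \<le> card (G i)"
  shows "hall_cond n K G"
  unfolding hall_cond_def
proof (intro allI impI)
  fix I assume I: "I \<subseteq> K" "I \<noteq> {}"
  have "(\<Sum>i\<in>I. card (F i)) \<le> (\<Sum>i\<in>I. card (G i))" using I assms(2) by (intro sum_mono) auto
  then show "n * card I * (card I - 1) < (\<Sum>i\<in>I. card (G i))"
    using hall_condD[OF assms(1) I] by linarith
qed

text \<open>Bijections of \<open>A\<close> and \<open>B\<close> with \<open>{0..<n}\<close> preserve
  sizes and disjointness. This makes the induction hypothesis applicable to the grid that remains
  after rows and columns are deleted.\<close>

lemma hall_sufficient_grid:
  assumes J: "hall_sufficient J" and fin: "finite A" "finite B" "card A = n" "card B = n"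
    and sub: "\<And>i. i \<in> J \<Longrightarrow> F i \<subseteq> A \<times> B" and hall: "hall_cond n J F"
  shows "rainbow J F"
proof -
  obtain f where f: "bij_betw f A {0..<n}" using ex_bij_betw_finite_nat[OF fin(1)] fin(3) by auto
  obtain g where g: "bij_betw g B {0..<n}" using ex_bij_betw_finite_nat[OF fin(2)] fin(4) by auto
  define G where "G i = map_prod f g ` F i" for i
  have inj: "inj_on (map_prod f g) (A \<times> B)"
    using f g by (intro map_prod_inj_on) (auto simp: bij_betw_def)
  have "card (G i) = card (F i)" if "i \<in> J" for i
    unfolding G_def by (rule card_image) (rule inj_on_subset[OF inj sub[OF that]])
  then have "hall_cond n J G" by (intro hall_cond_mono[OF hall]) simp
  moreover have "G i \<subseteq> {..<n} \<times> {..<n}" if "i \<in> J" for i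
    using sub[OF that] f g unfolding G_def bij_betw_def by fastforce
  ultimately have "rainbow J G" using J unfolding hall_sufficient_def by blast
  then obtain x y where xy: "\<And>i. i \<in> J \<Longrightarrow> (x i, y i) \<in> G i" "inj_on x J" "inj_on y J"
    by (rule rainbowE) blast
  have "\<forall>i\<in>J. \<exists>p. p \<in> F i \<and> x i = f (fst p) \<and> y i = g (snd p)"
    using xy(1) unfolding G_def by force
  then obtain p where p: "\<And>i. i \<in> J \<Longrightarrow> p i \<in> F i \<and> x i = f (fst (p i)) \<and> y i = g (snd (p i))"
    by metis
  show ?thesis unfolding rainbow_def
    using p xy(2,3) by (intro exI[of _ p]) (auto simp: inj_on_def)
qed

text \<open>Serve the colours in increasing order of \<open>x\<close>. By injectivity at most
  \<open>x c\<close> colours come before \<open>c\<close>, so they cannot use up \<open>S c\<close>,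
  which has more than \<open>x c\<close> elements.\<close>

lemma distinct_representatives_greedy:
  fixes x :: "'a \<Rightarrow> nat"
  assumes "finite K" "inj_on x K" "\<And>i. i \<in> K \<Longrightarrow> x i < card (S i)"
  shows "\<exists>z. (\<forall>i\<in>K. z i \<in> S i) \<and> inj_on z K"
  using assms
proof (induction K rule: finite_ranking_induct[where f = x])
  case empty then show ?case by simp
next
  case (insert c K)
  show ?case
  proof (cases "c \<in> K")
    case True then show ?thesis using insert by (simp add: insert_absorb)
  next
    case False
    obtain z where z: "\<forall>i\<in>K. z i \<in> S i" "inj_on z K" using insert by (auto simp: inj_on_insert)
    have "x i < x c" if "i \<in> K" for i
      using insert.hyps(2)[OF that] insert.prems(1) that False
      by (metis inj_on_def insertCI le_neq_implies_less)
    then have "card K \<le> card {..<x c}"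
      using insert.prems(1) by (intro card_inj_on_le[of x]) (auto simp: inj_on_insert)
    then have "card (z ` K) < card (S c)"
      using insert.prems(2)[of c] card_image_le[OF insert.hyps(1), of z] by simp
    then obtain s where s: "s \<in> S c" "s \<notin> z ` K"
      by (meson card_mono finite_imageI insert.hyps(1) linorder_not_le subsetI)
    have "inj_on (z(c := s)) (insert c K)"
      using z(2) s(2) False by (auto simp: inj_on_def)
    moreover have "\<forall>i\<in>insert c K. (z(c := s)) i \<in> S i" using z(1) s(1) by auto
    ultimately show ?thesis by blast
  qed
qed

section \<open>Compression to Young diagrams\<close>

definition push_fst :: "(nat \<times> nat) set \<Rightarrow> (nat \<times> nat) set" where
  "push_fst D = {(x, y). x < card {x'. (x', y) \<in> D}}"

lemma finite_column: "finite D \<Longrightarrow> finite {x. (x, y) \<in> D}"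
  by (rule finite_subset[of _ "fst ` D"]) force+

lemma push_fst_subset:
  assumes "D \<subseteq> {..<n} \<times> {..<n}"
  shows "push_fst D \<subseteq> {..<n} \<times> {..<n}"
proof -
  have "x < n \<and> y < n" if "x < card {x'. (x', y) \<in> D}" for x y
  proof -
    have "{x'. (x', y) \<in> D} \<subseteq> {..<n}" using assms by auto
    then have "card {x'. (x', y) \<in> D} \<le> n" using card_mono[of "{..<n}"] by fastforce
    moreover have "{x'. (x', y) \<in> D} \<noteq> {}" using that by (metis card.empty not_less0)
    ultimately show ?thesis using that assms by auto
  qed
  then show ?thesis unfolding push_fst_def by auto
qed

lemma card_by_columns:
  assumes "D \<subseteq> {..<n} \<times> {..<n::nat}"
  shows "card D = (\<Sum>y<n. card {x. (x, y) \<in> D})"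
proof -
  have D: "D = prod.swap ` Sigma {..<n} (\<lambda>y. {x. (x, y) \<in> D})" using assms by force
  have "finite D" using assms finite_subset by blast
  then have "card (Sigma {..<n} (\<lambda>y. {x. (x, y) \<in> D})) = (\<Sum>y<n. card {x. (x, y) \<in> D})"
    by (intro card_SigmaI) (auto intro: finite_column)
  then show ?thesis by (subst D) (simp add: card_image)
qed

lemma card_push_fst:
  assumes "D \<subseteq> {..<n} \<times> {..<n}"
  shows "card (push_fst D) = card D"
  unfolding card_by_columns[OF assms] card_by_columns[OF push_fst_subset[OF assms]]
  by (simp add: push_fst_def flip: lessThan_def)

text \<open>Keep the columns \<open>y i\<close> and choose the rows anew: a cell
  \<open>(x i, y i)\<close> of the pushed set says that column \<open>y i\<close> of
  \<open>F i\<close> has more than \<open>x i\<close> cells, which is what the greedy choice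
  requires.\<close>

lemma rainbow_push_fst:
  assumes "finite K" "rainbow K (\<lambda>i. push_fst (F i))"
  shows "rainbow K F"
proof -
  obtain x y where xy: "\<And>i. i \<in> K \<Longrightarrow> (x i, y i) \<in> push_fst (F i)" "inj_on x K" "inj_on y K"
    using assms(2) by (rule rainbowE) blast
  have "\<exists>z. (\<forall>i\<in>K. z i \<in> {x'. (x', y i) \<in> F i}) \<and> inj_on z K"
    using xy(1) by (intro distinct_representatives_greedy[OF assms(1) xy(2)]) (simp add: push_fst_def)
  then show ?thesis using xy(3) by (auto intro: rainbowI)
qed

text \<open>Push, transpose, push again. The result stays transposed, which is harmless because a
  rainbow matching can be transposed back.\<close>

lemma ex_down_closed_compression:
  assumes "finite K" "\<And>i. i \<in> K \<Longrightarrow> F i \<subseteq> {..<n} \<times> {..<n}"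
  shows "\<exists>G. (\<forall>i\<in>K. G i \<subseteq> {..<n} \<times> {..<n} \<and> down_closed (G i) \<and> card (G i) = card (F i)) \<and>
             (rainbow K G \<longrightarrow> rainbow K F)"
proof -
  define H where "H i = prod.swap ` push_fst (F i)" for i
  have H: "H i \<subseteq> {..<n} \<times> {..<n}" if "i \<in> K" for i
    using push_fst_subset[OF assms(2)[OF that]] unfolding H_def by auto
  \<comment> \<open>After the transposition the first push makes the columns of \<open>H i\<close>
    nested: column \<open>y\<close> is contained in column \<open>y'\<close> for
    \<open>y' \<le> y\<close>. Hence the column lengths do not increase with \<open>y\<close>, and
    the second push yields a down-closed set.\<close>
  have mono: "(x, y') \<in> H i" if "(x, y) \<in> H i" "y' \<le> y" for i x y y'
    using that unfolding H_def push_fst_def by force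
  have "down_closed (push_fst (H i))" if "i \<in> K" for i
    unfolding down_closed_def
  proof (intro allI impI)
    fix x y x' y' assume *: "(x, y) \<in> push_fst (H i)" "x' \<le> x" "y' \<le> y"
    have "finite (H i)" using H[OF that] finite_subset by blast
    then have "card {x'. (x', y) \<in> H i} \<le> card {x'. (x', y') \<in> H i}"
      using mono *(3) by (intro card_mono finite_column) auto
    then show "(x', y') \<in> push_fst (H i)" using * unfolding push_fst_def by simp
  qed
  moreover have "card (push_fst (H i)) = card (F i)" if "i \<in> K" for i
    using card_push_fst[OF H[OF that]] card_push_fst[OF assms(2)[OF that]]
    by (simp add: H_def card_image)
  moreover have "rainbow K (\<lambda>i. push_fst (H i)) \<Longrightarrow> rainbow K F"
    using rainbow_push_fst[OF assms(1), of H] rainbow_swap[of K "\<lambda>i. push_fst (F i)"]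
      rainbow_push_fst[OF assms(1), of F] unfolding H_def by blast
  ultimately show ?thesis using push_fst_subset[OF H]
    by (intro exI[of _ "\<lambda>i. push_fst (H i)"]) blast
qed

section \<open>Corner squares and saturation\<close>

lemma inj_on_rank:
  fixes x :: "'a \<Rightarrow> nat"
  assumes "finite K" "inj_on x K"
  shows "\<exists>z. inj_on z K \<and> (\<forall>i\<in>K. z i < card K \<and> z i \<le> x i)"
proof -
  define z where "z i = card {j\<in>K. x j < x i}" for i
  have less: "z i < z j" if "i \<in> K" "j \<in> K" "x i < x j" for i j
    unfolding z_def using that assms(1) by (intro psubset_card_mono) auto
  have "inj_on z K"
    using less assms(2) unfolding inj_on_def by (metis less_irrefl linorder_neqE_nat)
  moreover have "z i < card K" if "i \<in> K" for i
    unfolding z_def using that assms(1) by (intro psubset_card_mono) auto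
  moreover have "z i \<le> x i" if "i \<in> K" for i
  proof -
    have "card {j\<in>K. x j < x i} \<le> card {..<x i}"
      using assms(2) by (intro card_inj_on_le[of x]) (auto simp: inj_on_def)
    then show ?thesis by (simp add: z_def)
  qed
  ultimately show ?thesis by blast
qed

text \<open>Replace every row and every column used by its rank among those used. Coordinates only
  decrease, so the edges stay in the down-closed sets, and ranks are below
  \<open>card K\<close>.\<close>

lemma rainbow_in_corner:
  assumes "finite K" "rainbow K F" "\<And>i. i \<in> K \<Longrightarrow> down_closed (F i)"
  shows "rainbow K (\<lambda>i. F i \<inter> {..<card K} \<times> {..<card K})"
proof -
  obtain x y where xy: "\<And>i. i \<in> K \<Longrightarrow> (x i, y i) \<in> F i" "inj_on x K" "inj_on y K"
    using assms(2) by (rule rainbowE) blast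
  obtain x' where x': "inj_on x' K" "\<forall>i\<in>K. x' i < card K \<and> x' i \<le> x i"
    using inj_on_rank[OF assms(1) xy(2)] by blast
  obtain y' where y': "inj_on y' K" "\<forall>i\<in>K. y' i < card K \<and> y' i \<le> y i"
    using inj_on_rank[OF assms(1) xy(3)] by blast
  show ?thesis
    using x' y' down_closedD[OF assms(3) xy(1)] by (intro rainbowI[of K x' y']) auto
qed

lemma rainbow_Un:
  assumes "rainbow J (\<lambda>i. F i \<inter> A \<times> B)" "rainbow L (\<lambda>i. F i \<inter> (- A) \<times> (- B))"
  shows "rainbow (J \<union> L) F"
proof -
  obtain x y where xy: "\<And>i. i \<in> J \<Longrightarrow> (x i, y i) \<in> F i \<inter> A \<times> B" "inj_on x J" "inj_on y J"
    using assms(1) by (rule rainbowE) blast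
  obtain x' y' where xy': "\<And>i. i \<in> L \<Longrightarrow> (x' i, y' i) \<in> F i \<inter> (- A) \<times> (- B)" "inj_on x' L" "inj_on y' L"
    using assms(2) by (rule rainbowE) blast
  show ?thesis
  proof (rule rainbowI)
    show "((if i \<in> J then x i else x' i), (if i \<in> J then y i else y' i)) \<in> F i" if "i \<in> J \<union> L" for i
      using that xy(1)[of i] xy'(1)[of i] by auto
    show "inj_on (\<lambda>i. if i \<in> J then x i else x' i) (J \<union> L)"
      using xy(1) xy'(1) by (intro inj_on_disjoint_Un xy(2) xy'(2)) fastforce
    show "inj_on (\<lambda>i. if i \<in> J then y i else y' i) (J \<union> L)"
      using xy(1) xy'(1) by (intro inj_on_disjoint_Un xy(3) xy'(3)) fastforce
  qed
qed

text \<open>Cell \<open>k - 1\<close> is the \<open>k\<close>-th one counted from 0, so a first row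
  or column of length at least \<open>k\<close> is filled up to length \<open>n\<close>. Afterwards
  its length is either below \<open>k\<close> or equal to \<open>n\<close>.\<close>

definition saturate :: "nat \<Rightarrow> nat \<Rightarrow> (nat \<times> nat) set \<Rightarrow> (nat \<times> nat) set" where
  "saturate n k D = D \<union> (if (0, k - 1) \<in> D then {0} \<times> {..<n} else {})
                      \<union> (if (k - 1, 0) \<in> D then {..<n} \<times> {0} else {})"

text \<open>A row is filled only if \<open>(0, k - 1)\<close> is in \<open>D\<close>; its first
  \<open>k\<close> cells are then in \<open>D\<close> already. The same holds for columns, so all
  new cells lie outside the corner.\<close>

lemma saturate_in_corner:
  assumes "down_closed D"
  shows "saturate n k D \<inter> {..<k} \<times> {..<k} \<subseteq> D"
proof
  fix p assume p: "p \<in> saturate n k D \<inter> {..<k} \<times> {..<k}"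
  obtain x y where [simp]: "p = (x, y)" by fastforce
  show "p \<in> D"
    using p down_closedD[OF assms, of 0 "k - 1" x y] down_closedD[OF assms, of "k - 1" 0 x y]
    by (auto simp: saturate_def split: if_splits)
qed

lemma down_closed_saturate:
  assumes "down_closed D"
  shows "down_closed (saturate n k D)"
  unfolding down_closed_def
proof (intro allI impI)
  fix x y x' y' assume "(x, y) \<in> saturate n k D" "x' \<le> x" "y' \<le> y"
  then show "(x', y') \<in> saturate n k D"
    using down_closedD[OF assms, of x y x' y'] by (auto simp: saturate_def split: if_splits)
qed


section \<open>Lower bound on the slack of proper subsets\<close>

text \<open>Each \<open>F i\<close> has at most \<open>n * n\<close> cells, so the condition for all
  of \<open>K\<close> forces \<open>card K - 1 < n\<close>.\<close>

lemma card_le_side: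
  assumes "finite K" "K \<noteq> {}" "\<And>i. i \<in> K \<Longrightarrow> F i \<subseteq> {..<n} \<times> {..<n}" "hall_cond n K F"
  shows "card K \<le> n"
proof -
  have "card (F i) \<le> n * n" if "i \<in> K" for i
    using card_mono[OF _ assms(3)[OF that]] by (simp add: card_cartesian_product)
  then have "(\<Sum>i\<in>K. card (F i)) \<le> card K * (n * n)"
    using sum_bounded_above[of K "\<lambda>i. card (F i)" "n * n"] by simp
  then have "n * card K * (card K - 1) < n * card K * n"
    using hall_condD[OF assms(4) order.refl assms(2)] by (simp add: algebra_simps)
  then show ?thesis by auto
qed

lemma card_outside_corner:
  assumes "D \<subseteq> {..<n} \<times> {..<n}"
  shows "card D \<le> card (D \<inter> (- {..<m}) \<times> (- {..<m})) + (m * n + (n - m) * m)"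
proof -
  let ?E = "D \<inter> (- {..<m}) \<times> (- {..<m})"
  have fin: "finite D" using assms finite_subset by blast
  have "D \<subseteq> ?E \<union> ({..<m} \<times> {..<n} \<union> {m..<n} \<times> {..<m})" using assms by auto
  then have "card D \<le> card (?E \<union> ({..<m} \<times> {..<n} \<union> {m..<n} \<times> {..<m}))"
    using fin by (intro card_mono) auto
  also have "\<dots> \<le> card ?E + card ({..<m} \<times> {..<n} \<union> {m..<n} \<times> {..<m})" by (rule card_Un_le)
  also have "card ({..<m} \<times> {..<n} \<union> {m..<n} \<times> {..<m}) \<le> m * n + (n - m) * m"
    by (rule order.trans[OF card_Un_le]) (simp add: card_cartesian_product)
  finally show ?thesis by simp
qed

text \<open>Take \<open>L\<close> of minimal slack and match it in its corner. The other colours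
  cannot be matched outside that corner, so some \<open>I\<close> violates the condition there.
  Adding \<open>I\<close> to \<open>L\<close> then lowers the slack, which minimality allows only if
  \<open>L \<union> I = K\<close>; since \<open>K\<close> itself has positive slack, that of
  \<open>L\<close> must be large.\<close>

lemma rainbow_or_large_slack:
  assumes fin: "finite K" and IH: "\<And>J. J \<subset> K \<Longrightarrow> hall_sufficient J"
    and sub: "\<And>i. i \<in> K \<Longrightarrow> F i \<subseteq> {..<n} \<times> {..<n}"
    and down: "\<And>i. i \<in> K \<Longrightarrow> down_closed (F i)"
    and hall: "hall_cond n K F" and nr: "\<not> rainbow K F"
    and J: "J \<subset> K" "J \<noteq> {}"
  shows "n * card J * (card J - 1) + (card K - 1)\<^sup>2 < (\<Sum>i\<in>J. card (F i))"
proof -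
  \<comment> \<open>The slack is an integer, because truncated subtraction would spoil the algebra
    below.\<close>
  define s where "s J = int (\<Sum>i\<in>J. card (F i)) - int n * int (card J) * (int (card J) - 1)" for J
  have s_pos: "1 \<le> s I" if "I \<subseteq> K" "I \<noteq> {}" for I
  proof -
    have "card I \<ge> 1" using that fin by (simp add: Suc_leI card_gt_0_iff finite_subset)
    then have "int (n * card I * (card I - 1)) = int n * int (card I) * (int (card I) - 1)"
      by (simp add: of_nat_diff)
    then show ?thesis using hall_condD[OF hall that] unfolding s_def by linarith
  qed
  define P where "P = {J. J \<subset> K \<and> J \<noteq> {}}"
  have P: "finite P" "J \<in> P" using fin J unfolding P_def by (auto intro: finite_subset[of _ "Pow K"])
  then have "Min (s ` P) \<in> s ` P" by (intro Min_in) auto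
  then obtain L where L: "L \<in> P" "s L = Min (s ` P)" by auto
  have min: "s L \<le> s I" if "I \<in> P" for I using that P(1) L(2) by simp
  define m where "m = card L"
  have LK: "L \<subset> K" "L \<noteq> {}" "finite L" using L(1) fin unfolding P_def by (auto intro: finite_subset)
  have m1: "m \<ge> 1" using LK by (simp add: m_def Suc_leI card_gt_0_iff)
  have mn: "m \<le> n"
    using card_le_side[of K F n] fin LK sub hall card_mono[OF fin, of L] unfolding m_def by fastforce
  let ?G = "\<lambda>i. F i \<inter> (- {..<m}) \<times> (- {..<m})"
  have "rainbow L F"
    using IH[OF LK(1)] sub LK(1) hall_cond_subset[OF hall, of L] unfolding hall_sufficient_def by blast
  then have "rainbow L (\<lambda>i. F i \<inter> {..<m} \<times> {..<m})"
    unfolding m_def using LK down by (intro rainbow_in_corner) auto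
  then have "\<not> rainbow (K - L) ?G"
    using nr rainbow_Un[of L F "{..<m}" "{..<m}" "K - L"] LK(1) by (auto simp: Un_absorb1)
  moreover have "hall_sufficient (K - L)" using IH LK by blast
  moreover have "?G i \<subseteq> {m..<n} \<times> {m..<n}" if "i \<in> K - L" for i using sub[of i] that by auto
  ultimately have "\<not> hall_cond (n - m) (K - L) ?G"
    using hall_sufficient_grid[of "K - L" "{m..<n}" "{m..<n}" "n - m" ?G] by auto
  then obtain I where I: "I \<subseteq> K - L" "I \<noteq> {}"
    and le: "(\<Sum>i\<in>I. card (?G i)) \<le> (n - m) * card I * (card I - 1)"
    unfolding hall_cond_def by (auto simp: not_less)
  define l where "l = card I"
  have finI: "finite I" using I(1) fin finite_subset by blast
  then have l1: "l \<ge> 1" using I by (simp add: l_def Suc_leI card_gt_0_iff)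
  have "(\<Sum>i\<in>I. card (F i)) \<le> (\<Sum>i\<in>I. card (?G i) + (m * n + (n - m) * m))"
    using I(1) sub by (intro sum_mono card_outside_corner) auto
  also have "\<dots> \<le> (n - m) * l * (l - 1) + l * (m * n + (n - m) * m)"
    using le by (simp add: sum.distrib l_def)
  finally have "int (\<Sum>i\<in>I. card (F i)) \<le> int ((n - m) * l * (l - 1) + l * (m * n + (n - m) * m))"
    using of_nat_mono by blast
  also have "\<dots> = (int n - int m) * int l * (int l - 1) + int l * (int m * int n + (int n - int m) * int m)"
    using mn l1 by (simp add: of_nat_diff)
  finally have sumI: "int (\<Sum>i\<in>I. card (F i)) \<le> \<dots>" .
  have "L \<inter> I = {}" using I(1) by blast
  then have LI: "card (L \<union> I) = m + l" "(\<Sum>i\<in>L \<union> I. card (F i)) = (\<Sum>i\<in>L. card (F i)) + (\<Sum>i\<in>I. card (F i))"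
    using LK(3) finI by (auto simp: m_def l_def card_Un_disjoint sum.union_disjoint)
  \<comment> \<open>All terms containing \<open>n\<close> cancel:
    \<open>n * (m + l) * (m + l - 1)\<close> splits into the terms for \<open>m\<close> and for
    \<open>l\<close> plus \<open>2 * n * m * l\<close>, and the last equals the
    \<open>n\<close>-part of the cells lost in the first \<open>m\<close> rows and columns.\<close>
  have sLI: "s (L \<union> I) \<le> s L - int l * int m * (int m + int l - 1)"
    using sumI unfolding s_def LI m_def[symmetric] by (simp add: algebra_simps)
  have pos: "0 < int l * int m * (int m + int l - 1)" using l1 m1 by simp
  have "L \<union> I \<notin> P" using min[of "L \<union> I"] sLI pos by linarith
  then have K: "L \<union> I = K" using LK I(1) unfolding P_def by blast
  have k: "int (card K - 1) = int m + int l - 1" using K LI(1) m1 by auto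
  \<comment> \<open>This gives \<open>l * m \<ge> m + l - 1 = card K - 1\<close>, so the drop in
    slack is at least \<open>(card K - 1)^2\<close>.\<close>
  have "0 \<le> (int l - 1) * (int m - 1)" using l1 m1 by simp
  then have "int m + int l - 1 \<le> int l * int m" by (simp add: algebra_simps)
  then have "(int m + int l - 1) * (int m + int l - 1) \<le> int l * int m * (int m + int l - 1)"
    using m1 by (intro mult_right_mono) auto
  then have "(int (card K - 1))\<^sup>2 < s J"
    using sLI s_pos[of K] K min[OF P(2)] LK unfolding k power2_eq_square by fastforce
  moreover have "card J \<ge> 1" 
    using J fin finite_subset[of J K] by (auto simp: Suc_le_eq card_gt_0_iff)
  ultimately have "int (n * card J * (card J - 1) + (card K - 1)\<^sup>2) < int (\<Sum>i\<in>J. card (F i))"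
    unfolding s_def by (simp add: of_nat_diff)
  then show ?thesis by (simp only: of_nat_less_iff)
qed

section \<open>Deleting a row and a column\<close>

text \<open>With \<open>j = |I|\<close>, the numbers \<open>A\<close> and \<open>R\<close> are the total sizes of the diagrams in \<open>I\<close> before and after the
  deletion, \<open>a = |F c|\<close>, and \<open>U\<close> sums the heights minus one of the deleted column.\<close>

lemma removal_arith:
  fixes n j y a A R U k :: int
  assumes j: "1 \<le> j" and n: "2 \<le> n" and U: "0 \<le> U" "U \<le> j * (n - 1)"
    and R1: "A \<le> R + n * j + U" and R2: "(y - 1) * U \<le> R"
    and aA: "n * (j + 1) * j < a + A" and min: "j * a \<le> A"
    and slack: "j = k - 1 \<or> n * (j + 1) * j + (k - 1)\<^sup>2 < a + A"
    and y: "1 \<le> y" "y = n \<or> y \<le> k - 1 \<and> a \<le> y\<^sup>2"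
  shows "(n - 1) * j * (j - 1) < R"
proof (cases "y = n")
  case True
  \<comment> \<open>Minimality of \<open>a\<close> bounds \<open>j * a\<close> by \<open>A\<close>,
    so \<open>a\<close> can be eliminated from \<open>aA\<close>.\<close>
  have "j * (n * (j + 1) * j) < j * (a + A)" using aA j by simp
  also have "\<dots> \<le> (j + 1) * A" using min by (simp add: algebra_simps)
  finally have "(j + 1) * (n * j * j) < (j + 1) * A" by (simp add: algebra_simps)
  then have A: "n * j * j < A" using j by simp
  show ?thesis
  \<comment> \<open>If \<open>U\<close> is small, little is deleted and \<open>R1\<close> suffices;
    if it is large, a large rectangle survives and \<open>R2\<close> suffices. The threshold makes
    both bounds reach the goal.\<close>
  proof (cases "U \<le> j * (j - 1)")
    case True then show ?thesis using A R1 by (simp add: algebra_simps)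
  next
    case False
    then have "(n - 1) * (j * (j - 1)) < (n - 1) * U" using n by simp
    then show ?thesis using R2 \<open>y = n\<close> by (simp add: algebra_simps)
  qed
next
  case False
  then have yk: "y \<le> k - 1" "a \<le> y\<^sup>2" using y by auto
  then have ak: "a \<le> (k - 1)\<^sup>2" using power_mono[of y "k - 1" 2] y by linarith
  show ?thesis
  \<comment> \<open>A small \<open>a\<close> leaves enough for \<open>A\<close> in
    \<open>aA\<close>. Otherwise \<open>j < y\<close>, and the slack term absorbs \<open>a\<close>;
    a second threshold for \<open>U\<close> then decides between \<open>R1\<close> and
    \<open>R2\<close>.\<close>
  proof (cases "a \<le> j\<^sup>2")
    case True
    then show ?thesis using aA R1 U by (simp add: algebra_simps power2_eq_square)
  next
    case False
    then have "j \<noteq> k - 1" using ak by auto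
    then have A: "n * (j + 1) * j < A" using slack ak by linarith
    have "j\<^sup>2 < y\<^sup>2" using False yk by linarith
    then have jy: "j < y" using y by (simp add: power2_less_imp_less)
    show ?thesis
    proof (cases "U \<le> (n - 1) * (j - 1)")
      case True
      then show ?thesis using A R1 n j
        by (simp add: algebra_simps) (use zero_le_square[of j] in linarith)
    next
      case False
      then have "j * ((n - 1) * (j - 1)) < j * U" using j by simp
      also have "\<dots> \<le> (y - 1) * U" using jy U by (intro mult_right_mono) auto
      finally show ?thesis using R2 by (simp add: algebra_simps)
    qed
  qed
qed

lemma initial_segment_eq:
  fixes S :: "nat set"
  assumes "finite S" "\<And>x x'. x \<in> S \<Longrightarrow> x' \<le> x \<Longrightarrow> x' \<in> S"
  shows "S = {..<card S}"
proof -
  have "x < card S" if "x \<in> S" for x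
    using card_mono[of S "{..x}"] that assms by fastforce
  then have "S \<subseteq> {..<card S}" by auto
  then show ?thesis by (intro card_subset_eq) auto
qed

lemma finite_row: "finite D \<Longrightarrow> finite {y. (x, y) \<in> D}"
  by (rule finite_subset[of _ "snd ` D"]) force+

lemma down_closed_column:
  assumes "finite D" "down_closed D"
  shows "(x, y) \<in> D \<longleftrightarrow> x < card {x. (x, y) \<in> D}"
  using initial_segment_eq[OF finite_column[OF assms(1)], of y] down_closedD[OF assms(2)] by auto

lemma down_closed_row:
  assumes "finite D" "down_closed D"
  shows "(x, y) \<in> D \<longleftrightarrow> y < card {y. (x, y) \<in> D}"
  using initial_segment_eq[OF finite_row[OF assms(1)], of x] down_closedD[OF assms(2)] by auto

text \<open>Colour \<open>c\<close> gets the cell \<open>(0, y - 1)\<close> at the end of its first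
  row. If column \<open>y - 1\<close> of another diagram is tall, that diagram contains a large
  rectangle to the left of it, which survives the deletion.\<close>

lemma removal_step:
  assumes fin: "finite K" and IH: "\<And>J. J \<subset> K \<Longrightarrow> hall_sufficient J"
    and sub: "\<And>i. i \<in> K \<Longrightarrow> F i \<subseteq> {..<n} \<times> {..<n}"
    and down: "\<And>i. i \<in> K \<Longrightarrow> down_closed (F i)"
    and hall: "hall_cond n K F"
    and c: "c \<in> K" "\<And>i. i \<in> K \<Longrightarrow> card (F c) \<le> card (F i)"
    and slack: "\<And>J. J \<subset> K \<Longrightarrow> J \<noteq> {} \<Longrightarrow>
      n * card J * (card J - 1) + (card K - 1)\<^sup>2 < (\<Sum>i\<in>J. card (F i))"
    and sat: "(0, card K - 1) \<in> F c \<Longrightarrow> (0, n - 1) \<in> F c"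
    and wide: "card {x. (x, 0) \<in> F c} \<le> card {y. (0, y) \<in> F c}"
  shows "rainbow K F"
proof -
  have finF: "finite (F i)" if "i \<in> K" for i using sub[OF that] finite_subset by blast
  define y where "y = card {y. (0, y) \<in> F c}"
  have row: "(0, t) \<in> F c \<longleftrightarrow> t < y" for t
    unfolding y_def by (rule down_closed_row) (use c finF down in auto)
  have "card (F c) > 0" using hall_condD[OF hall, of "{c}"] c by simp
  then have "F c \<noteq> {}" by auto
  then have "(0, 0) \<in> F c" using down_closedD[OF down[OF c(1)], of _ _ 0 0] by fastforce
  then have y1: "y \<ge> 1" using row by simp
  have yn: "y \<le> n" using row[of "y - 1"] sub[OF c(1)] y1 by auto
  have "F c \<subseteq> {..<y} \<times> {..<y}"
  proof
    fix p assume "p \<in> F c"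
    then obtain s t where p: "p = (s, t)" "(s, t) \<in> F c" by (cases p) auto
    then have "(s, 0) \<in> F c" "(0, t) \<in> F c" using down_closedD[OF down[OF c(1)] p(2)] by auto
    then show "p \<in> {..<y} \<times> {..<y}"
      using p(1) row[of t] down_closed_column[OF finF[OF c(1)] down[OF c(1)], of s 0] wide
      unfolding y_def[symmetric] by simp
  qed
  then have ay: "card (F c) \<le> y\<^sup>2"
    using card_mono[of "{..<y} \<times> {..<y}" "F c"] by (simp add: card_cartesian_product power2_eq_square)
  \<comment> \<open>A first row longer than \<open>card K - 1\<close> contains the cell tested by
    \<open>sat\<close>, hence reaches the last column.\<close>
  have yk: "y = n \<or> y \<le> card K - 1"
  proof (cases "card K - 1 < y")
    case True then show ?thesis using sat row[of "card K - 1"] row[of "n - 1"] yn by auto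
  qed auto
  have kn: "card K \<le> n" using card_le_side[of K F n] fin c sub hall by auto
  define G where "G i = F i \<inter> (- {0}) \<times> (- {y - 1})" for i
  define h where "h i = card {x. (x, y - 1) \<in> F i}" for i
  \<comment> \<open>The cell of the column in row 0 is left out, as the deleted row is already
    charged with \<open>n\<close> cells. For an empty column truncation gives 0.\<close>
  define u where "u i = h i - 1" for i
  have col: "(x, y - 1) \<in> F i \<longleftrightarrow> x < h i" if "i \<in> K" for i x
    unfolding h_def by (rule down_closed_column) (use that finF down in auto)
  have G1: "card (F i) \<le> card (G i) + n + u i" if i: "i \<in> K" for i
  proof -
    let ?C = "{1..<h i} \<times> {y - 1}"
    have "F i \<subseteq> G i \<union> ({0} \<times> {..<n} \<union> ?C)"
      using sub[OF i] col[OF i] unfolding G_def by (fastforce simp: Suc_le_eq)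
    then have "card (F i) \<le> card (G i \<union> ({0} \<times> {..<n} \<union> ?C))"
      using finF[OF i] by (intro card_mono) (auto simp: G_def)
    also have "\<dots> \<le> card (G i) + (card ({0::nat} \<times> {..<n}) + card ?C)"
      by (intro order.trans[OF card_Un_le] add_left_mono card_Un_le)
    finally show ?thesis by (simp add: u_def card_cartesian_product)
  qed
  have G2: "(y - 1) * u i \<le> card (G i)" if i: "i \<in> K" for i
  proof -
    have "{1..<h i} \<times> {..<y - 1} \<subseteq> G i"
    proof
      fix p assume "p \<in> {1..<h i} \<times> {..<y - 1}"
      then obtain s t where p: "p = (s, t)" "1 \<le> s" "s < h i" "t < y - 1" by auto
      then have "(s, t) \<in> F i" using down_closedD[OF down[OF i], of s "y - 1" s t] col[OF i, of s] by simp
      then show "p \<in> G i" using p by (simp add: G_def)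
    qed
    then have "card ({1..<h i} \<times> {..<y - 1}) \<le> card (G i)"
      using finF[OF i] by (intro card_mono) (auto simp: G_def)
    then show ?thesis by (simp add: u_def card_cartesian_product mult.commute)
  qed
  have G3: "u i \<le> n - 1" if i: "i \<in> K" for i
  proof -
    have "{x. (x, y - 1) \<in> F i} \<subseteq> {..<n}" using sub[OF i] by auto
    then have "h i \<le> n" using card_mono[of "{..<n}"] unfolding h_def by fastforce
    then show ?thesis by (simp add: u_def)
  qed
  have "hall_cond (n - 1) (K - {c}) G"
    unfolding hall_cond_def
  proof (intro allI impI)
    fix I assume I: "I \<subseteq> K - {c}" "I \<noteq> {}"
    have finI: "finite I" using I(1) fin finite_subset by blast
    have j1: "card I \<ge> 1" using I(2) finI by (simp add: Suc_leI card_gt_0_iff)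
    have cI: "c \<notin> I" "insert c I \<subseteq> K" using I c by auto
    have k2: "card I \<le> card K - 1" using card_mono[OF fin cI(2)] cI(1) finI by simp
    have sums: "(\<Sum>i\<in>insert c I. card (F i)) = card (F c) + (\<Sum>i\<in>I. card (F i))"
      "card (insert c I) = card I + 1" using cI(1) finI by auto
    have IK: "i \<in> K" if "i \<in> I" for i using I that by auto
    have "(int n - 1) * int (card I) * (int (card I) - 1) < int (\<Sum>i\<in>I. card (G i))"
    proof (rule removal_arith)
      show "1 \<le> int (card I)" using j1 by simp
      show "2 \<le> int n" using k2 j1 kn by linarith
      show "0 \<le> int (\<Sum>i\<in>I. u i)" by (rule of_nat_0_le_iff)
      have "(\<Sum>i\<in>I. u i) \<le> card I * (n - 1)"
        using sum_bounded_above[of I u "n - 1"] G3 IK by simp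
      then have "int (\<Sum>i\<in>I. u i) \<le> int (card I * (n - 1))" using of_nat_mono by blast
      then show "int (\<Sum>i\<in>I. u i) \<le> int (card I) * (int n - 1)"
        using k2 j1 kn by (simp add: of_nat_diff)
      have "(\<Sum>i\<in>I. card (F i)) \<le> (\<Sum>i\<in>I. card (G i) + n + u i)"
        using G1 IK by (intro sum_mono) auto
      then have "(\<Sum>i\<in>I. card (F i)) \<le> (\<Sum>i\<in>I. card (G i)) + n * card I + (\<Sum>i\<in>I. u i)"
        by (simp add: sum.distrib mult.commute)
      then show "int (\<Sum>i\<in>I. card (F i)) \<le> int (\<Sum>i\<in>I. card (G i)) + int n * int (card I) + int (\<Sum>i\<in>I. u i)"
        by (simp only: of_nat_le_iff flip: of_nat_add of_nat_mult)
      have "(y - 1) * (\<Sum>i\<in>I. u i) \<le> (\<Sum>i\<in>I. card (G i))"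
        unfolding sum_distrib_left using G2 IK by (intro sum_mono) auto
      then have "int ((y - 1) * (\<Sum>i\<in>I. u i)) \<le> int (\<Sum>i\<in>I. card (G i))" using of_nat_mono by blast
      then show "(int y - 1) * int (\<Sum>i\<in>I. u i) \<le> int (\<Sum>i\<in>I. card (G i))"
        using y1 by (simp add: of_nat_diff)
      have "n * (card I + 1) * card I < card (F c) + (\<Sum>i\<in>I. card (F i))"
        using hall_condD[OF hall cI(2)] unfolding sums by simp
      then have "int (n * (card I + 1) * card I) < int (card (F c) + (\<Sum>i\<in>I. card (F i)))"
        by (simp only: of_nat_less_iff)
      then show "int n * (int (card I) + 1) * int (card I) < int (card (F c)) + int (\<Sum>i\<in>I. card (F i))"
        by (simp add: algebra_simps)
      have "card I * card (F c) \<le> (\<Sum>i\<in>I. card (F i))"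
        using sum_bounded_below[of I "card (F c)" "\<lambda>i. card (F i)"] c(2) IK by simp
      then show "int (card I) * int (card (F c)) \<le> int (\<Sum>i\<in>I. card (F i))"
        by (simp only: of_nat_le_iff flip: of_nat_mult)
      \<comment> \<open>The slack bound covers proper subsets only; the first alternative is the
        case that \<open>I\<close> and \<open>c\<close> exhaust \<open>K\<close>.\<close>
      show "int (card I) = int (card K) - 1 \<or>
        int n * (int (card I) + 1) * int (card I) + (int (card K) - 1)\<^sup>2
          < int (card (F c)) + int (\<Sum>i\<in>I. card (F i))"
      proof (cases "insert c I = K")
        case True then show ?thesis using sums(2) by auto
      next
        case False
        then have "n * (card I + 1) * card I + (card K - 1)\<^sup>2 < card (F c) + (\<Sum>i\<in>I. card (F i))"
          using slack[of "insert c I"] cI(2) unfolding sums by auto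
        then have "int (n * (card I + 1) * card I + (card K - 1)\<^sup>2)
            < int (card (F c) + (\<Sum>i\<in>I. card (F i)))"
          by (simp only: of_nat_less_iff)
        moreover have "int (card K - 1) = int (card K) - 1" using k2 j1 by linarith
        ultimately show ?thesis by (simp add: algebra_simps)
      qed
      show "1 \<le> int y" using y1 by simp
      have "int (card (F c)) \<le> (int y)\<^sup>2" using ay by (simp only: of_nat_le_iff flip: of_nat_power)
      then show "int y = int n \<or> int y \<le> int (card K) - 1 \<and> int (card (F c)) \<le> (int y)\<^sup>2"
        using yk k2 j1 by linarith
    qed
    then have "int ((n - 1) * card I * (card I - 1)) < int (\<Sum>i\<in>I. card (G i))"
      using j1 k2 kn by (simp add: of_nat_diff)
    then show "(n - 1) * card I * (card I - 1) < (\<Sum>i\<in>I. card (G i))" by (simp only: of_nat_less_iff)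
  qed
  moreover have "hall_sufficient (K - {c})" using IH c by blast
  \<comment> \<open>The deleted column need not be the last one, so the remaining grid has to be
    relabelled.\<close>
  moreover have "G i \<subseteq> {1..<n} \<times> ({..<n} - {y - 1})" if "i \<in> K - {c}" for i
    using sub[of i] that unfolding G_def by (fastforce simp: Suc_le_eq)
  moreover have "card ({..<n} - {y - 1}) = n - 1" using y1 yn by (subst card_Diff_singleton) auto
  ultimately have "rainbow (K - {c}) G"
    using hall_sufficient_grid[of "K - {c}" "{1..<n}" "{..<n} - {y - 1}" "n - 1" G] by auto
  moreover have "rainbow {c} (\<lambda>i. F i \<inter> {0} \<times> {y - 1})"
    using row[of "y - 1"] y1 by (intro rainbowI[of _ "\<lambda>_. 0" "\<lambda>_. y - 1"]) auto
  ultimately show ?thesis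
    using rainbow_Un[of "{c}" F "{0}" "{y - 1}" "K - {c}"] c(1) by (simp add: G_def[abs_def] insert_absorb)
qed

section \<open>The induction on the set of colours\<close>

text \<open>Arguing by contradiction makes the slack bound available. The smallest diagram is then
  removed, after transposing all diagrams if its first column is longer than its first row.\<close>

lemma rainbow_saturated:
  assumes fin: "finite K" "K \<noteq> {}" and IH: "\<And>J. J \<subset> K \<Longrightarrow> hall_sufficient J"
    and sub: "\<And>i. i \<in> K \<Longrightarrow> F i \<subseteq> {..<n} \<times> {..<n}"
    and down: "\<And>i. i \<in> K \<Longrightarrow> down_closed (F i)"
    and hall: "hall_cond n K F"
    and sat: "\<And>i. i \<in> K \<Longrightarrow> (0, card K - 1) \<in> F i \<Longrightarrow> (0, n - 1) \<in> F i"
      "\<And>i. i \<in> K \<Longrightarrow> (card K - 1, 0) \<in> F i \<Longrightarrow> (n - 1, 0) \<in> F i"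
  shows "rainbow K F"
proof (rule ccontr)
  assume nr: "\<not> rainbow K F"
  note slack = rainbow_or_large_slack[OF fin(1) IH sub down hall nr]
  have "Min ((\<lambda>i. card (F i)) ` K) \<in> (\<lambda>i. card (F i)) ` K" using fin by (intro Min_in) auto
  then obtain c where c: "c \<in> K" "card (F c) = Min ((\<lambda>i. card (F i)) ` K)" by auto
  then have min: "card (F c) \<le> card (F i)" if "i \<in> K" for i using that fin(1) by simp
  show False
  proof (cases "card {x. (x, 0) \<in> F c} \<le> card {y. (0, y) \<in> F c}")
    case True
    then have "rainbow K F"
      using c(1) min sat(1)[OF c(1)] by (intro removal_step[OF fin(1) IH sub down hall _ _ slack]) auto
    then show False using nr by simp
  next
    case False
    let ?S = "\<lambda>i. prod.swap ` F i"
    have mem: "(x, y) \<in> ?S i \<longleftrightarrow> (y, x) \<in> F i" for x y i by force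
    have card: "card (?S i) = card (F i)" for i by (simp add: card_image)
    have "rainbow K ?S"
    proof (rule removal_step[OF fin(1) IH _ _ _ c(1)])
      show "?S i \<subseteq> {..<n} \<times> {..<n}" if "i \<in> K" for i using sub[OF that] by auto
      show "down_closed (?S i)" if "i \<in> K" for i
        using down[OF that] unfolding down_closed_def mem by blast
      show "hall_cond n K ?S" by (rule hall_cond_mono[OF hall]) (simp add: card)
    qed (use min slack sat(2)[OF c(1)] False in \<open>auto simp: card mem\<close>)
    then show False using nr rainbow_swap by blast
  qed
qed

lemma hall_sufficient_finite:
  assumes "finite K"
  shows "hall_sufficient K"
  using assms
proof (induction K rule: finite_psubset_induct)
  case (psubset K)
  show ?case
    unfolding hall_sufficient_def
  proof (intro allI impI)
    fix n and F :: "'a \<Rightarrow> (nat \<times> nat) set"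
    assume sub: "\<forall>i\<in>K. F i \<subseteq> {..<n} \<times> {..<n}" and hall: "hall_cond n K F"
    show "rainbow K F"
    proof (cases "K = {}")
      case True then show ?thesis by (auto simp: rainbow_def)
    next
      case False
      have "F i \<subseteq> {..<n} \<times> {..<n}" if "i \<in> K" for i using sub that by simp
      from ex_down_closed_compression[where F = F, OF psubset.hyps(1) this]
      obtain G where "\<forall>i\<in>K. G i \<subseteq> {..<n} \<times> {..<n} \<and> down_closed (G i) \<and> card (G i) = card (F i)"
        and GF: "rainbow K G \<longrightarrow> rainbow K F" by auto
      then have G: "\<And>i. i \<in> K \<Longrightarrow> G i \<subseteq> {..<n} \<times> {..<n}" "\<And>i. i \<in> K \<Longrightarrow> down_closed (G i)"
          "\<And>i. i \<in> K \<Longrightarrow> card (G i) = card (F i)" by simp_all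
      define H where "H i = saturate n (card K) (G i)" for i
      have n: "card K \<le> n" "0 < card K"
        using card_le_side[OF psubset.hyps(1) False, of F n] sub hall False psubset.hyps(1)
        by (auto simp: card_gt_0_iff)
      have H: "H i \<subseteq> {..<n} \<times> {..<n}" if "i \<in> K" for i
        using G(1)[OF that] n unfolding H_def saturate_def by auto
      have "card (F i) \<le> card (H i)" if "i \<in> K" for i
        unfolding G(3)[OF that, symmetric] using H[OF that] finite_subset
        by (intro card_mono) (auto simp: H_def saturate_def)
      then have hallH: "hall_cond n K H" by (rule hall_cond_mono[OF hall])
      have downH: "down_closed (H i)" if "i \<in> K" for i
        unfolding H_def using G that by (intro down_closed_saturate) auto
      \<comment> \<open>The cell \<open>(0, card K - 1)\<close> lies in the corner, where saturation
        adds nothing. It was thus in \<open>G i\<close> before, and the row has been filled.\<close>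
      have row: "(0, n - 1) \<in> H i" if "i \<in> K" "(0, card K - 1) \<in> H i" for i
      proof -
        have "(0, card K - 1) \<in> G i"
          using that saturate_in_corner[OF G(2)[OF that(1)], of n "card K"] n unfolding H_def by auto
        then show ?thesis using n by (simp add: H_def saturate_def)
      qed
      have column: "(n - 1, 0) \<in> H i" if "i \<in> K" "(card K - 1, 0) \<in> H i" for i
      proof -
        have "(card K - 1, 0) \<in> G i"
          using that saturate_in_corner[OF G(2)[OF that(1)], of n "card K"] n unfolding H_def by auto
        then show ?thesis using n by (simp add: H_def saturate_def)
      qed
      have "rainbow K H"
        by (rule rainbow_saturated[OF psubset.hyps(1) False psubset.IH H downH hallH row column])
      \<comment> \<open>Moving the matching into the corner avoids all cells added by saturation, so
        it becomes one for \<open>G\<close>.\<close>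
      then have "rainbow K (\<lambda>i. H i \<inter> {..<card K} \<times> {..<card K})"
        using psubset.hyps(1) downH by (intro rainbow_in_corner) auto
      then have "rainbow K G"
        by (rule rainbow_mono) (unfold H_def, intro saturate_in_corner G(2))
      then show ?thesis using GF by simp
    qed
  qed
qed

theorem theorem4p1:
  fixes n k :: nat and F :: "nat \<Rightarrow> (nat \<times> nat) set"
  assumes "n \<ge> 1" and "k \<ge> 1"
    and "\<And>i. i \<in> {1..k} \<Longrightarrow> F i \<subseteq> edges_Knn n"
    and "\<And>I. I \<subseteq> {1..k} \<Longrightarrow> I \<noteq> {} \<Longrightarrow>
           (\<Sum>i\<in>I. card (F i)) > n * card I * (card I - 1)"
  shows "has_rainbow_matching k F"
proof -
  have "hall_cond n {1..k} F" using assms(4) unfolding hall_cond_def by blast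
  moreover have "\<forall>i\<in>{1..k}. F i \<subseteq> {..<n} \<times> {..<n}"
    using assms(3) unfolding edges_Knn_def lessThan_atLeast0 by blast
  ultimately have "rainbow {1..k} F"
    using hall_sufficient_finite[of "{1..k}"] unfolding hall_sufficient_def by blast
  then show ?thesis
    unfolding rainbow_def has_rainbow_matching_def disjoint_edges_def inj_on_def by metis
qed

end
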